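(* Let $C_n$ be the Catalan numbers, defined by $\sum_{n\ge0}C_nz^n=\frac{1-\sqrt{1-4z}}{2z}$. If the general PI tree is built from the input sequence $g_n=C_{n-1}$ ($n\ge1$), then its row sums are $x_n=C_n$ for all $n\ge1$. Consequently, for all $n\ge1$, \[ C_n=\sum_{m=1}^{n}\sum_{\substack{k_1+\dots+k_m=n\\ k_i\ge1}} C_{k_1-1}\cdots C_{k_m-1} \quad\text{and}\quad C_{n-1}=\sum_{m=1}^{n}(-1)^{m+1}\sum_{\substack{k_1+\dots+k_m=n\\ k_i\ge1}} C_{k_1}\cdots C_{k_m}. \]
   Context: General PI tree: given an input sequence $\{g_n\}_{n\ge1}$, build a binary tree whose nodes are words $g_{i_1}\cdots g_{i_k}$; the root (row 1) is $g_1$, and each node $g_{i_1}g_{i_2}\cdots g_{i_k}$ has the two children $g_1g_{i_1}g_{i_2}\cdots g_{i_k}$ and $g_{i_1+1}g_{i_2}\cdots g_{i_k}$. Row $n$ contains $2^{n-1}$ words, and its row sum $x_n$ is the sum over those words of the products of the numbers $g_i$. *)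

theory Defs
  imports Complex_Main "HOL-Computational_Algebra.Formal_Power_Series"
begin

text \<open>A word $g_{i_1} \cdots g_{i_k}$ is represented by its list of indices $[i_1, \ldots, i_k]$.
  The empty word is not a node of the tree.\<close>

fun pi_children :: "nat list \<Rightarrow> nat list list" where
  "pi_children [] = []"
| "pi_children (i # w) = [1 # i # w, (i + 1) # w]"

text \<open>Rows are numbered from 1; row 0 is a dummy.\<close>

fun pi_row :: "nat \<Rightarrow> nat list list" where
  "pi_row 0 = []"
| "pi_row (Suc 0) = [[1]]"
| "pi_row (Suc (Suc n)) = concat (map pi_children (pi_row (Suc n)))"

definition pi_row_sum :: "(nat \<Rightarrow> 'a::comm_semiring_1) \<Rightarrow> nat \<Rightarrow> 'a" where
  "pi_row_sum g n = (\<Sum>w\<leftarrow>pi_row n. prod_list (map g w))"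

text \<open>The series $\frac{1 - \sqrt{1 - 4z}}{2z}$ is read as a formal power series. The formal square
  root is the one with constant coefficient \<open>root 2 1 = 1\<close>, so the numerator is divisible by $2z$
  and the quotient is exact.\<close>

definition catalan_fps :: "real fps" where
  "catalan_fps =
     (1 - fps_radical root 2 (1 - fps_const 4 * fps_X)) / (fps_const 2 * fps_X)"

lemma catalan_fps_exact:
  "fps_const 2 * fps_X * catalan_fps = 1 - fps_radical root 2 (1 - fps_const 4 * fps_X)"
proof -
  let ?N = "1 - fps_radical root 2 (1 - fps_const 4 * fps_X) :: real fps"
  have N0: "fps_nth ?N 0 = 0" by (simp add: numeral_2_eq_2)
  define M where "M = fps_const (1/2) * fps_shift 1 ?N"
  have "?N = fps_const 2 * fps_X * M"
    unfolding M_def using N0 by (intro fps_ext) (auto simp: mult.assoc)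
  then have "fps_const 2 * fps_X dvd ?N" by (metis dvd_triv_left)
  then show ?thesis unfolding catalan_fps_def by simp
qed

definition catalan :: "nat \<Rightarrow> real" where
  "catalan n = fps_nth catalan_fps n"

definition compositions :: "nat \<Rightarrow> nat \<Rightarrow> nat list set" where
  "compositions n m = {ks. length ks = m \<and> (\<forall>k\<in>set ks. k \<ge> 1) \<and> sum_list ks = n}"

lemma finite_compositions: "finite (compositions n m)"
proof (rule finite_subset)
  show "compositions n m \<subseteq> {ks. set ks \<subseteq> {..n} \<and> length ks = m}"
    by (auto simp: compositions_def intro: member_le_sum_list)
  show "finite {ks. set ks \<subseteq> {..n} \<and> length ks = m}"
    by (rule finite_lists_length_eq) simp
qed

lemma pi_row_nonempty_words: "[] \<notin> set (pi_row n)"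
proof (induction n rule: pi_row.induct)
  case (3 n)
  have "[] \<notin> set (pi_children w)" for w
    by (cases w) auto
  then show ?case by auto
qed auto

lemma length_pi_row: "length (pi_row (Suc n)) = 2 ^ n"
proof (induction n)
  case (Suc n)
  have *: "length (concat (map pi_children ws)) = 2 * length ws" if "[] \<notin> set ws" for ws
    using that
  proof (induction ws)
    case (Cons w ws)
    then show ?case by (cases w) auto
  qed simp
  show ?case
    using Suc *[OF pi_row_nonempty_words[of "Suc n"]] by simp
qed simp

end

theory Submission
  imports Defs
begin

text \<open>Row \<open>n\<close> of the tree lists every composition of \<open>n\<close> exactly once: a composition of \<open>n + 1\<close>
  either starts with a part 1, or arises by increasing the first part of a composition of \<open>n\<close>.
  Sums over compositions of \<open>n\<close> with \<open>m\<close> parts are coefficients of \<open>m\<close>-th powers of power series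
  without constant term, so both identities come from geometric series. With \<open>C\<close> the Catalan series,
  the functional equation \<open>C * (1 - z * C) = 1\<close> says that \<open>C\<close> is the inverse of \<open>1 - z * C\<close> and that
  \<open>1 - z * C\<close> is the inverse of \<open>1 + (C - 1)\<close>.\<close>

text \<open>Splitting off the first part mirrors the Cauchy product
  \<open>G * G ^ m\<close>.\<close>

lemma sum_compositions_Suc:
  "(\<Sum>ks\<in>compositions n (Suc m). f ks) =
   (\<Sum>k=1..n. \<Sum>ks\<in>compositions (n - k) m. f (k # ks))"
proof -
  have "compositions n (Suc m) = (\<lambda>(k, ks). k # ks) ` Sigma {1..n} (\<lambda>k. compositions (n - k) m)"
    by (auto simp: compositions_def length_Suc_conv image_iff)
  moreover have "inj_on (\<lambda>(k, ks). k # ks) (Sigma {1..n} (\<lambda>k. compositions (n - k) m))"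
    by (auto simp: inj_on_def)
  ultimately show ?thesis
    by (simp add: sum.reindex sum.Sigma finite_compositions case_prod_unfold)
qed

lemma fps_power_nth_compositions:
  fixes G :: "'a::comm_ring_1 fps"
  assumes "fps_nth G 0 = 0"
  shows "fps_nth (G ^ m) n = (\<Sum>ks\<in>compositions n m. prod_list (map (fps_nth G) ks))"
proof (induction m arbitrary: n)
  case 0
  have "compositions n 0 = (if n = 0 then {[]} else {})"
    by (auto simp: compositions_def)
  then show ?case by simp
next
  case (Suc m)
  have "fps_nth (G ^ Suc m) n = (\<Sum>k=0..n. fps_nth G k * fps_nth (G ^ m) (n - k))"
    by (simp add: fps_mult_nth)
  \<comment> \<open>The missing constant term of \<open>G\<close> is what excludes parts equal to
    0.\<close>
  also have "\<dots> = (\<Sum>k=1..n. fps_nth G k * fps_nth (G ^ m) (n - k))"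
    using assms by (simp add: sum.atLeast_Suc_atMost)
  also have "\<dots> = (\<Sum>ks\<in>compositions n (Suc m). prod_list (map (fps_nth G) ks))"
    by (simp add: Suc sum_compositions_Suc sum_distrib_left)
  finally show ?case .
qed

text \<open>\<open>A\<close> is the sum of all powers of \<open>G\<close>. Truncation at
  \<open>n\<close> is exact because \<open>G ^ Suc n\<close> has no terms of degree at most
  \<open>n\<close>, and the power 0 contributes only to degree 0.\<close>

lemma fps_geometric_nth:
  fixes A G :: "'a::idom fps"
  assumes inv: "A * (1 - G) = 1" and G0: "fps_nth G 0 = 0" and "n \<ge> 1"
  shows "(\<Sum>m=1..n. fps_nth (G ^ m) n) = fps_nth A n"
proof -
  have "(\<Sum>m\<le>n. G ^ m) = A * ((1 - G) * (\<Sum>m\<le>n. G ^ m))"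
    using inv by (simp add: mult.assoc[symmetric])
  also have "\<dots> = A - A * G ^ Suc n"
    by (simp only: sum_gp_basic) (simp add: algebra_simps)
  finally have "(\<Sum>m\<le>n. G ^ m) = A - A * G ^ Suc n" .
  then have "fps_nth (\<Sum>m\<le>n. G ^ m) n = fps_nth A n - fps_nth (A * G ^ Suc n) n"
    by (simp only: fps_sub_nth)
  moreover have "fps_nth (A * G ^ Suc n) n = 0"
    unfolding fps_mult_nth
    by (intro sum.neutral ballI) (simp add: startsby_zero_power_prefix[OF G0] del: power_Suc)
  ultimately have "(\<Sum>m\<le>n. fps_nth (G ^ m) n) = fps_nth A n"
    by (simp add: fps_sum_nth)
  then show ?thesis
    using \<open>n \<ge> 1\<close> by (simp add: atMost_atLeast0 sum.atLeast_Suc_atMost)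
qed

text \<open>Squaring 1 - 2zC = sqrt(1 - 4z) and cancelling 4z gives the functional equation.\<close>

lemma catalan_fps_inverse: "catalan_fps * (1 - fps_X * catalan_fps) = 1"
proof -
  let ?R = "fps_radical root 2 (1 - fps_const 4 * fps_X) :: real fps"
  have "?R ^ Suc 1 = 1 - fps_const 4 * fps_X"
    using power_radical[of "1 - fps_const 4 * fps_X :: real fps" root 1] by (simp add: numeral_2_eq_2)
  then have "(1 - fps_const 2 * fps_X * catalan_fps) ^ 2 = 1 - fps_const 4 * fps_X"
    by (simp add: catalan_fps_exact numeral_2_eq_2)
  then have "4 * fps_X * (catalan_fps * (1 - fps_X * catalan_fps)) = 4 * fps_X * 1"
    by (simp add: numeral_fps_const[symmetric] power2_eq_square algebra_simps)
  then show ?thesis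
    by (subst (asm) mult_cancel_left) simp
qed

lemma catalan_0: "catalan 0 = 1"
  using arg_cong[OF catalan_fps_inverse, of "\<lambda>F. fps_nth F 0"] by (simp add: catalan_def)

lemma set_pi_row:
  "set (pi_row (Suc n)) = {ks. (\<forall>k\<in>set ks. k \<ge> 1) \<and> sum_list ks = Suc n}"
proof (induction n)
  case 0
  have "ks = [1]" if "\<forall>k\<in>set ks. k \<ge> 1" "sum_list ks = 1" for ks :: "nat list"
    using that by (cases ks; cases "tl ks") (fastforce simp: add_is_1)+
  then show ?case by auto
next
  case (Suc n)
  show ?case (is "?L = ?R")
  proof (intro equalityI subsetI)
    fix w assume "w \<in> ?L"
    then obtain v where v: "v \<in> set (pi_row (Suc n))" "w \<in> set (pi_children v)"
      by auto
    from v(1) have "(\<forall>k\<in>set v. k \<ge> 1) \<and> sum_list v = Suc n"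
      unfolding Suc by simp
    with v(2) show "w \<in> ?R"
      by (cases v rule: pi_children.cases) auto
  next
    fix w assume w: "w \<in> ?R"
    then obtain k ks where [simp]: "w = k # ks" by (cases w) auto
    show "w \<in> ?L"
    \<comment> \<open>The head determines the parent: a leading 1 is deleted, a larger head is
      decreased. In the first case \<open>ks\<close> is nonempty, since it sums to
      \<open>Suc n\<close>; this matters because \<open>[]\<close> has no children.\<close>
    proof (cases "k = 1")
      case True
      with w have "ks \<in> set (pi_row (Suc n))" by (auto simp: Suc)
      moreover have "w \<in> set (pi_children ks)"
        using w True by (cases ks) auto
      ultimately show ?thesis by auto
    next
      case False
      with w have "(k - 1) # ks \<in> set (pi_row (Suc n))" by (auto simp: Suc)
      moreover have "w \<in> set (pi_children ((k - 1) # ks))"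
        using w by auto
      ultimately show ?thesis by (auto simp del: pi_children.simps)
    qed
  qed
qed

text \<open>A child determines its parent: entries are positive, so an incremented head is at least
  2 and never collides with a prepended 1.\<close>

lemma distinct_pi_row: "distinct (pi_row n)"
proof (induction n rule: pi_row.induct)
  case (3 n)
  have pos: "\<exists>i u. w = i # u \<and> i \<ge> 1" if "w \<in> set (pi_row (Suc n))" for w
    using that unfolding set_pi_row by (cases w rule: list.exhaust) auto
  have disj: "set (pi_children v) \<inter> set (pi_children w) = {}"
    if "v \<in> set (pi_row (Suc n))" "w \<in> set (pi_row (Suc n))" "v \<noteq> w" for v w
    using pos[OF that(1)] pos[OF that(2)] that(3) by auto
  have "inj_on pi_children (set (pi_row (Suc n)))"
    by (rule inj_onI) (auto dest!: pos)
  moreover have "distinct (pi_children w)" if "w \<in> set (pi_row (Suc n))" for w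
    using pos[OF that] by auto
  ultimately show ?case
    unfolding pi_row.simps
    by (intro distinct_concat) (use 3 disj in \<open>auto simp: distinct_map\<close>)
qed auto

lemma pi_row_sum_compositions:
  assumes "n \<ge> 1"
  shows "pi_row_sum g n = (\<Sum>m=1..n. \<Sum>ks\<in>compositions n m. prod_list (map g ks))"
proof -
  \<comment> \<open>This bounds the number of parts by \<open>n\<close>, so the row can be grouped
    by word length.\<close>
  have len: "length ks \<le> sum_list ks" if "\<forall>k\<in>set ks. k \<ge> 1" for ks :: "nat list"
    using that by (induction ks) auto
  have "set (pi_row n) = (\<Union>m\<in>{1..n}. compositions n m)"
    using assms set_pi_row[of "n - 1"] len by (auto simp: compositions_def Suc_le_eq)
  moreover have "pi_row_sum g n = (\<Sum>ks\<in>set (pi_row n). prod_list (map g ks))"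
    by (simp add: pi_row_sum_def sum_list_distinct_conv_sum_set distinct_pi_row)
  moreover have "compositions n i \<inter> compositions n j = {}" if "i \<noteq> j" for i j
    using that by (auto simp: compositions_def)
  ultimately show ?thesis
    by (simp add: sum.UNION_disjoint finite_compositions)
qed

text \<open>Index 0 never occurs as a part, so values there are free: \<open>g\<close> is prescribed
  only from 1 on, and C - 1 differs from C only at 0.\<close>

lemma sum_compositions_cong:
  assumes "\<And>k. k \<ge> 1 \<Longrightarrow> f k = g k"
  shows "(\<Sum>ks\<in>compositions n m. prod_list (map f ks)) =
    (\<Sum>ks\<in>compositions n m. prod_list (map g ks))"
proof (rule sum.cong[OF refl])
  fix ks assume "ks \<in> compositions n m"
  then have "map f ks = map g ks"
    using assms by (auto simp: compositions_def)
  then show "prod_list (map f ks) = prod_list (map g ks)"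
    by (rule arg_cong)
qed

lemma catalan_eq_sum_compositions:
  assumes "n \<ge> 1"
  shows "catalan n =
    (\<Sum>m=1..n. \<Sum>ks\<in>compositions n m. prod_list (map (\<lambda>k. catalan (k - 1)) ks))"
proof -
  let ?G = "fps_X * catalan_fps"
  have "catalan n = (\<Sum>m=1..n. fps_nth (?G ^ m) n)"
    using fps_geometric_nth[OF catalan_fps_inverse _ assms] by (simp add: catalan_def)
  also have "\<dots> = (\<Sum>m=1..n. \<Sum>ks\<in>compositions n m. prod_list (map (fps_nth ?G) ks))"
    by (simp add: fps_power_nth_compositions)
  also have "\<dots> = (\<Sum>m=1..n. \<Sum>ks\<in>compositions n m. prod_list (map (\<lambda>k. catalan (k - 1)) ks))"
    by (intro sum.cong[OF refl] sum_compositions_cong) (simp add: catalan_def)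
  finally show ?thesis .
qed

lemma catalan_eq_alternating_sum_compositions:
  assumes "n \<ge> 1"
  shows "catalan (n - 1) =
    (\<Sum>m=1..n. (-1) ^ (m + 1) * (\<Sum>ks\<in>compositions n m. prod_list (map catalan ks)))"
proof -
  let ?H = "catalan_fps - 1"
  have H0: "fps_nth ?H 0 = 0"
    using catalan_0 by (simp add: catalan_def)
  \<comment> \<open>Here C is read as 1 - (-H), so its inverse 1 - zC is a geometric series in -H;
    this is the source of the alternating signs.\<close>
  have inv: "(1 - fps_X * catalan_fps) * (1 - (- ?H)) = 1"
    using catalan_fps_inverse by (simp add: mult.commute)
  have sgn: "fps_nth ((- ?H) ^ m) n = (-1) ^ m * fps_nth (?H ^ m) n" for m
    by (cases "even m") (simp_all add: power_minus_even power_minus_odd del: minus_diff_eq)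
  \<comment> \<open>The minus sign here turns the exponent \<open>m\<close> of -1 into
    \<open>m + 1\<close>.\<close>
  have "catalan (n - 1) = - fps_nth (1 - fps_X * catalan_fps) n"
    using assms by (simp add: catalan_def)
  also have "\<dots> = - (\<Sum>m=1..n. fps_nth ((- ?H) ^ m) n)"
    using H0 by (subst fps_geometric_nth[OF inv _ assms]) simp_all
  also have "\<dots> = (\<Sum>m=1..n. (-1) ^ (m + 1) * fps_nth (?H ^ m) n)"
    by (simp only: sgn sum_negf[symmetric]) simp
  also have "\<dots> = (\<Sum>m=1..n. (-1) ^ (m + 1) *
      (\<Sum>ks\<in>compositions n m. prod_list (map (fps_nth ?H) ks)))"
    by (simp only: fps_power_nth_compositions[OF H0])
  also have "\<dots> = (\<Sum>m=1..n. (-1) ^ (m + 1) *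
      (\<Sum>ks\<in>compositions n m. prod_list (map catalan ks)))"
    by (intro sum.cong[OF refl] arg_cong2[where f = "(*)"] sum_compositions_cong)
      (simp_all add: catalan_def)
  finally show ?thesis .
qed

theorem theorem7:
  fixes g :: "nat \<Rightarrow> real"
  assumes g: "\<And>n. n \<ge> 1 \<Longrightarrow> g n = catalan (n - 1)"
  shows "(\<forall>n\<ge>1. pi_row_sum g n = catalan n) \<and>
    (\<forall>n\<ge>1. catalan n =
      (\<Sum>m=1..n. \<Sum>ks\<in>compositions n m. prod_list (map (\<lambda>k. catalan (k - 1)) ks))) \<and>
    (\<forall>n\<ge>1. catalan (n - 1) =
      (\<Sum>m=1..n. (-1) ^ (m + 1) * (\<Sum>ks\<in>compositions n m. prod_list (map catalan ks))))"
proof (intro conjI allI impI)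
  fix n :: nat assume n: "n \<ge> 1"
  have "pi_row_sum g n = (\<Sum>m=1..n. \<Sum>ks\<in>compositions n m. prod_list (map g ks))"
    by (rule pi_row_sum_compositions[OF n])
  also have "\<dots> = (\<Sum>m=1..n. \<Sum>ks\<in>compositions n m. prod_list (map (\<lambda>k. catalan (k - 1)) ks))"
    by (intro sum.cong[OF refl] sum_compositions_cong g)
  also have "\<dots> = catalan n"
    by (rule catalan_eq_sum_compositions[OF n, symmetric])
  finally show "pi_row_sum g n = catalan n" .
qed (fact catalan_eq_sum_compositions catalan_eq_alternating_sum_compositions)+

end
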